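(* Let $X\neq\{0\}$ be a real Hilbert space, let $A:X\to X$ be a positive definite and invertible linear operator, and let $D:=\{x\in X:\langle Ax,x\rangle\leq 1\}$. The following statements hold: (a) $D$ is bounded, convex and closed, and has $0$ in its interior. (b) $\mathscr{M}_D(x)=\sqrt{\langle Ax,x\rangle}$ for each $x\in X$. (c) $D^{\circ}=\{x\in X:\langle A^{-1}x,x\rangle\leq 1\}$.
   Context: A linear operator $A:X\to X$ is positive definite if it is continuous, self-adjoint ($A=A^*$) and $\langle Ax,x\rangle>0$ for all $0\neq x\in X$. For $\emptyset\neq C\subseteq X$, the polar set is $C^{\circ}:=\{x^*\in X:\langle x^*,c\rangle\leq 1\ \ \forall c\in C\}$, and the Minkowski functional is $\mathscr{M}_C(x):=\inf\{\mu\geq 0:x\in\mu C\}$ for $x\in X$, where $\mu C=\{\mu c:c\in C\}$ and $\inf\emptyset:=\infty$. *)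

theory Defs
  imports "HOL-Analysis.Analysis"
begin

text \<open>
  Real Hilbert spaces are types of sort \<open>{real_inner, complete_space}\<close>. There the library's
  \<open>adjoint A\<close>, which is some \<open>B\<close> with \<open>\<forall>x y. A x \<bullet> y = x \<bullet> B y\<close>, is the usual adjoint for every
  continuous linear \<open>A\<close>: existence of such a \<open>B\<close> is the Riesz representation theorem, and
  uniqueness is immediate.
\<close>

definition positive_definite :: "('a::{real_inner, complete_space} \<Rightarrow> 'a) \<Rightarrow> bool" where
  "positive_definite A \<longleftrightarrow>
     linear A \<and> continuous_on UNIV A \<and> A = adjoint A \<and> (\<forall>x. x \<noteq> 0 \<longrightarrow> A x \<bullet> x > 0)"

definition polar :: "'a::real_inner set \<Rightarrow> 'a set" where
  "polar C = {y. \<forall>c\<in>C. y \<bullet> c \<le> 1}"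

text \<open>The values are extended reals, where \<open>Inf {} = \<infinity>\<close>.\<close>

definition minkowski_functional :: "'a::real_vector set \<Rightarrow> 'a \<Rightarrow> ereal" where
  "minkowski_functional C x = Inf {ereal \<mu> | \<mu>. \<mu> \<ge> 0 \<and> x \<in> (\<lambda>c. \<mu> *\<^sub>R c) ` C}"

end

theory Submission
  imports Defs
begin

text \<open>
  Write \<open>q x = A x \<bullet> x\<close>. Everything rests on the Cauchy-Schwarz inequality
  \<open>(A x \<bullet> y)\<^sup>2 \<le> q x * q y\<close> for the form of \<open>A\<close> (\<open>symmetric_form_Cauchy_Schwarz\<close>).
  It makes \<open>sqrt \<circ> q\<close> a norm whose unit ball is \<open>D\<close>, which gives convexity and the formula for
  the Minkowski functional. Substituting \<open>A\<^sup>-\<^sup>1 y\<close> for \<open>y\<close>, it says that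
  \<open>x \<bullet> y \<le> sqrt (q x) * sqrt (A\<^sup>-\<^sup>1 y \<bullet> y)\<close>, with equality at \<open>x = A\<^sup>-\<^sup>1 y\<close>; so the dual norm is
  \<open>y \<mapsto> sqrt (A\<^sup>-\<^sup>1 y \<bullet> y)\<close>, and the polar of \<open>D\<close> is its unit ball. Closedness of \<open>D\<close> and
  \<open>0 \<in> interior D\<close> only express that \<open>q\<close> is continuous.

  Boundedness of \<open>D\<close> is where invertibility and completeness enter. The inequality above bounds
  every functional \<open>x \<mapsto> x \<bullet> y\<close> on \<open>D\<close>, and a weakly bounded subset of a Hilbert space is bounded
  by the Baire category theorem (\<open>weakly_bounded_imp_bounded\<close>). This avoids a separate proof that
  \<open>A\<^sup>-\<^sup>1\<close> is continuous.

  One point concerns the definition of self-adjointness: \<open>adjoint A\<close> is a choice among the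
  operators \<open>B\<close> with \<open>A x \<bullet> y = x \<bullet> B y\<close>, so \<open>A = adjoint A\<close> yields the symmetry of \<open>A\<close> only once
  such a \<open>B\<close> is known to exist. Its existence is the Riesz representation theorem
  (\<open>Riesz_representation\<close>), obtained by minimising \<open>(norm x)\<^sup>2 / 2 - f x\<close>.
\<close>

section \<open>Riesz representation and adjoints\<close>

lemma linear_continuous_imp_bounded_linear:
  fixes f :: "'a::real_normed_vector \<Rightarrow> 'b::real_normed_vector"
  assumes lin: "linear f" and cont: "continuous_on UNIV f"
  shows "bounded_linear f"
proof -
  have "isCont f 0"
    using cont by (simp add: continuous_on_eq_continuous_at)
  then obtain d where d: "d > 0" and small: "\<And>x. norm x < d \<Longrightarrow> norm (f x) < 1"
    unfolding continuous_at_eps_delta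
    by (metis dist_0_norm dist_commute lin linear_0 zero_less_one)
  have "norm (f x) \<le> norm x * (2 / d)" for x
  proof (cases "x = 0")
    case True
    then show ?thesis using lin by (simp add: linear_0)
  next
    case False
    let ?c = "d / (2 * norm x)"
    have "norm (?c *\<^sub>R x) < d"
      using False d by simp
    then have "norm (f (?c *\<^sub>R x)) < 1"
      by (rule small)
    then have "?c * norm (f x) < 1"
      using False d lin by (simp add: linear_cmul)
    then show ?thesis
      using False d by (simp add: field_simps)
  qed
  then show ?thesis
    using lin by (intro bounded_linear_intro[where K = "2 / d"]) (auto simp: linear_add linear_cmul)
qed

text \<open>
  The representing vector is the minimiser of the strictly convex energy
  \<open>g x = (norm x)\<^sup>2 / 2 - f x\<close>: it exists because the parallelogram law makes minimising sequences
  Cauchy, and vanishing of the derivative of \<open>g\<close> at \<open>v\<close> is the equation \<open>v \<bullet> h = f h\<close>.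
\<close>
theorem Riesz_representation:
  fixes f :: "'a::{real_inner, complete_space} \<Rightarrow> real"
  assumes "bounded_linear f"
  shows "\<exists>v. \<forall>h. f h = v \<bullet> h"
proof -
  interpret bounded_linear f by fact
  define g where "g x = (x \<bullet> x) / 2 - f x" for x
  obtain K where K: "\<And>x. norm (f x) \<le> norm x * K"
    using bounded by blast
  have below: "- (K\<^sup>2 / 2) \<le> g x" for x
  proof -
    have "f x \<le> norm x * K"
      using K[of x] by simp
    moreover have "0 \<le> (norm x - K)\<^sup>2"
      by simp
    ultimately show ?thesis
      by (simp add: g_def power2_norm_eq_inner[symmetric] power2_diff)
  qed
  define m where "m = (INF x. g x)"
  have bdd: "bdd_below (range g)"
    using below by (auto intro!: bdd_belowI)
  have m_le: "m \<le> g x" for x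
    unfolding m_def using bdd by (simp add: cINF_lower)
  have "\<exists>x. g x < m + 1 / Suc n" for n
    using cINF_less_iff[OF _ bdd, of "m + 1 / Suc n"] unfolding m_def by auto
  then obtain X where X: "\<And>n. g (X n) < m + 1 / Suc n"
    by metis
  have parallelogram: "(norm (x - y))\<^sup>2 = 4 * (g x + g y - 2 * g ((1/2) *\<^sub>R (x + y)))" for x y
    by (simp add: g_def power2_norm_eq_inner scaleR add inner_simps inner_commute field_simps)
  have close: "(norm (X i - X j))\<^sup>2 \<le> 8 / Suc N" if "i \<ge> N" "j \<ge> N" for i j N
  proof -
    define r where "r = 1 / real (Suc N)"
    have "1 / Suc i \<le> r" "1 / Suc j \<le> r"
      using that by (auto simp: r_def field_simps)
    then have "g (X i) \<le> m + r" "g (X j) \<le> m + r"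
      using X[of i] X[of j] by linarith+
    then have "(norm (X i - X j))\<^sup>2 \<le> 8 * r"
      using parallelogram[of "X i" "X j"] m_le[of "(1/2) *\<^sub>R (X i + X j)"] by argo
    then show ?thesis by (simp add: r_def)
  qed
  have "Cauchy X"
  proof (rule CauchyI)
    fix e :: real
    assume e: "e > 0"
    obtain N where "8 / e\<^sup>2 < real N"
      using reals_Archimedean2 by blast
    then have "8 / Suc N < e\<^sup>2"
      using e by (simp add: field_simps) (smt (verit) zero_less_power)
    then have "norm (X i - X j) < e" if "i \<ge> N" "j \<ge> N" for i j
      using close[OF that] e by (meson le_less_trans less_imp_le power2_less_imp_less)
    then show "\<exists>N. \<forall>i\<ge>N. \<forall>j\<ge>N. norm (X i - X j) < e"
      by blast
  qed
  then obtain v where v: "X \<longlonglongrightarrow> v"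
    using Cauchy_convergent_iff convergent_def by blast
  have "(\<lambda>n. g (X n)) \<longlonglongrightarrow> g v"
    unfolding g_def by (intro tendsto_intros v tendsto) simp
  moreover have "(\<lambda>n. m + 1 / Suc n) \<longlonglongrightarrow> m + 0"
    by (intro tendsto_intros LIMSEQ_Suc[OF lim_1_over_n])
  ultimately have "g v \<le> m + 0"
    by (rule LIMSEQ_le) (use X less_imp_le in blast)
  then have min: "g v \<le> g x" for x
    using m_le[of x] by linarith
  have "f h = v \<bullet> h" for h
  proof (cases "h = 0")
    case True
    then show ?thesis by (simp add: zero)
  next
    case False
    let ?b = "v \<bullet> h - f h"
    let ?t = "- ?b / (h \<bullet> h)"
    \<comment> \<open>\<open>?t\<close> minimises \<open>g\<close> on the line \<open>v + t h\<close>, where it would save \<open>?b\<^sup>2 / (2 (h \<bullet> h))\<close>.\<close>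
    have pos: "h \<bullet> h > 0"
      using False by simp
    have "g (v + t *\<^sub>R h) - g v = t * ?b + t\<^sup>2 * (h \<bullet> h) / 2" for t
      by (simp add: g_def scaleR add inner_simps inner_commute power2_eq_square field_simps)
    then have "g (v + ?t *\<^sub>R h) - g v = ?t * ?b + ?t\<^sup>2 * (h \<bullet> h) / 2" .
    also have "\<dots> = - (?b\<^sup>2 / (2 * (h \<bullet> h)))"
      using pos by (simp add: power2_eq_square field_simps)
    finally have "?b\<^sup>2 / (2 * (h \<bullet> h)) \<le> 0"
      using min[of "v + ?t *\<^sub>R h"] by linarith
    then have "?b\<^sup>2 \<le> 0"
      using pos by (simp add: divide_le_0_iff)
    then show ?thesis by simp
  qed
  then show ?thesis by blast
qed

theorem adjoint_inner:
  fixes A :: "'a::{real_inner, complete_space} \<Rightarrow> 'b::real_inner"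
  assumes "bounded_linear A"
  shows "A x \<bullet> y = x \<bullet> adjoint A y"
proof -
  have "\<exists>v. \<forall>x. A x \<bullet> y = v \<bullet> x" for y
    using assms by (intro Riesz_representation bounded_linear_inner_left_comp)
  then obtain B where B: "\<And>x y. A x \<bullet> y = x \<bullet> B y"
    by (metis inner_commute)
  then have "adjoint A = B"
    by (intro adjoint_unique) blast
  with B show ?thesis
    by metis
qed

section \<open>Weakly bounded sets\<close>

text \<open>
  The sets \<open>C n\<close> of functionals bounded by \<open>n\<close> on \<open>D\<close> are closed and cover the space, so by Baire
  one of them contains a ball; differences of its members then bound all functionals from a ball
  around \<open>0\<close> uniformly on \<open>D\<close>.
\<close>
theorem weakly_bounded_imp_bounded:
  fixes D :: "'a::{real_inner, complete_space} set"
  assumes weak: "\<And>y. \<exists>K. \<forall>x\<in>D. \<bar>x \<bullet> y\<bar> \<le> K"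
  shows "bounded D"
proof -
  define C where "C n = {y. \<forall>x\<in>D. \<bar>x \<bullet> y\<bar> \<le> real n}" for n
  have closed: "closed (C n)" for n
  proof -
    have "C n = (\<Inter>x\<in>D. {y. \<bar>x \<bullet> y\<bar> \<le> real n})"
      by (auto simp: C_def)
    also have "closed \<dots>"
      by (intro closed_INT ballI closed_Collect_le continuous_intros)
    finally show ?thesis .
  qed
  have "y \<in> \<Union>(range C)" for y
  proof -
    obtain K where "\<forall>x\<in>D. \<bar>x \<bullet> y\<bar> \<le> K"
      using weak by blast
    moreover obtain n where "K \<le> real n"
      using real_arch_simple by blast
    ultimately have "y \<in> C n"
      by (force simp: C_def)
    then show ?thesis by blast
  qed
  then have cover: "\<Union>(range C) = UNIV"
    by blast
  have "\<exists>n. interior (C n) \<noteq> {}"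
  proof (rule ccontr)
    assume "\<not> ?thesis"
    then have "Met_TC.mtopology interior_of \<Union>(range C) = {}"
      using closed complete_UNIV by (intro Met_TC.metric_Baire_category_alt) auto
    then show False
      by (simp add: cover)
  qed
  then obtain n z e where e: "e > 0" and ball: "ball z e \<subseteq> C n"
    by (metis all_not_in_conv mem_interior)
  have "norm x \<le> 4 * real n / e" if x: "x \<in> D" for x
  proof (cases "x = 0")
    case True
    then show ?thesis using e by simp
  next
    case False
    define h where "h = (e / (2 * norm x)) *\<^sub>R x"
    have "norm h < e"
      using False e by (simp add: h_def)
    then have "z + h \<in> C n" "z \<in> C n"
      using ball e by (auto simp: dist_norm subset_iff)
    then have "\<bar>x \<bullet> (z + h)\<bar> \<le> real n" "\<bar>x \<bullet> z\<bar> \<le> real n"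
      using x by (auto simp: C_def)
    then have "x \<bullet> h \<le> 2 * real n"
      by (simp add: inner_add_right)
    moreover have "x \<bullet> h = e / 2 * norm x"
      using False by (simp add: h_def power2_norm_eq_inner[symmetric] power2_eq_square)
    ultimately show ?thesis
      using e by (simp add: field_simps)
  qed
  then show ?thesis
    unfolding bounded_iff by blast
qed

section \<open>The form of a positive operator\<close>

lemma symmetric_form_Cauchy_Schwarz:
  fixes A :: "'a::real_inner \<Rightarrow> 'a"
  assumes lin: "linear A" and sym: "\<And>x y. A x \<bullet> y = x \<bullet> A y"
    and nonneg: "\<And>x. A x \<bullet> x \<ge> 0"
  shows "(A x \<bullet> y)\<^sup>2 \<le> (A x \<bullet> x) * (A y \<bullet> y)"
proof -
  let ?a = "A y \<bullet> y" and ?b = "A x \<bullet> y" and ?c = "A x \<bullet> x"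
  have quadratic: "0 \<le> ?c + 2 * t * ?b + t\<^sup>2 * ?a" for t
  proof -
    have "A y \<bullet> x = ?b"
      by (metis sym inner_commute)
    then have "A (x + t *\<^sub>R y) \<bullet> (x + t *\<^sub>R y) = ?c + 2 * t * ?b + t\<^sup>2 * ?a"
      using lin by (simp add: linear_add linear_cmul inner_simps power2_eq_square algebra_simps)
    then show ?thesis
      using nonneg[of "x + t *\<^sub>R y"] by simp
  qed
  show ?thesis
  proof (cases "?a = 0")
    case True
    have "?b = 0"
    proof (rule ccontr)
      assume "?b \<noteq> 0"
      \<comment> \<open>An affine function of slope \<open>2 * ?b \<noteq> 0\<close> takes the value \<open>-1\<close> somewhere.\<close>
      then show False
        using quadratic[of "- (?c + 1) / (2 * ?b)"] True by (simp add: field_simps)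
    qed
    then show ?thesis
      using True by simp
  next
    case False
    then have "?a > 0"
      using nonneg[of y] by linarith
    then show ?thesis
      using quadratic[of "- ?b / ?a"] by (simp add: field_simps power2_eq_square)
  qed
qed

lemma positive_definite_imp_symmetric:
  assumes "positive_definite A"
  shows "A x \<bullet> y = x \<bullet> A y"
proof -
  have "bounded_linear A" "adjoint A = A"
    using assms by (auto simp: positive_definite_def intro: linear_continuous_imp_bounded_linear)
  then show ?thesis
    using adjoint_inner[of A x y] by simp
qed

section \<open>The unit ball of the form\<close>

theorem lemma3p7:
  fixes A :: "'a::{real_inner, complete_space} \<Rightarrow> 'a"
    and D :: "'a set"
  assumes nontrivial: "(UNIV :: 'a set) \<noteq> {0}"
    and A_posdef: "positive_definite A"
    and A_invertible: "bij A"
    and D_def: "D = {x. A x \<bullet> x \<le> 1}"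
  shows "(bounded D \<and> convex D \<and> closed D \<and> 0 \<in> interior D)
    \<and> (\<forall>x. minkowski_functional D x = ereal (sqrt (A x \<bullet> x)))
    \<and> polar D = {x. inv A x \<bullet> x \<le> 1}"
proof -
  have lin: "linear A" and cont: "continuous_on UNIV A"
    and pos: "\<And>x. x \<noteq> 0 \<Longrightarrow> A x \<bullet> x > 0"
    using A_posdef by (auto simp: positive_definite_def)
  note sym = positive_definite_imp_symmetric[OF A_posdef]
  have nonneg: "A x \<bullet> x \<ge> 0" for x
    using pos[of x] by (cases "x = 0") auto
  have q_scale: "A (t *\<^sub>R x) \<bullet> (t *\<^sub>R x) = t\<^sup>2 * (A x \<bullet> x)" for t x
    using lin by (simp add: linear_cmul power2_eq_square)
  have CS: "\<bar>A x \<bullet> y\<bar> \<le> sqrt (A x \<bullet> x) * sqrt (A y \<bullet> y)" for x y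
    using symmetric_form_Cauchy_Schwarz[OF lin sym nonneg, of x y]
    by (metis real_sqrt_abs real_sqrt_le_iff real_sqrt_mult)
  have A_inv: "A (inv A y) = y" for y
    using A_invertible by (simp add: bij_is_surj surj_f_inv_f)
  have dual: "\<bar>x \<bullet> y\<bar> \<le> sqrt (inv A y \<bullet> y)" if "x \<in> D" for x y
  proof -
    have "\<bar>x \<bullet> y\<bar> \<le> sqrt (A x \<bullet> x) * sqrt (y \<bullet> inv A y)"
      using CS[of x "inv A y"] sym[of x "inv A y"] by (simp add: A_inv)
    also have "\<dots> \<le> 1 * sqrt (y \<bullet> inv A y)"
      using that nonneg[of "inv A y"] by (intro mult_right_mono) (auto simp: D_def A_inv)
    finally show ?thesis
      by (simp add: inner_commute)
  qed

  have "bounded D"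
    using dual by (intro weakly_bounded_imp_bounded) blast
  moreover have "convex D"
  proof (rule convexI)
    fix x y and u v :: real
    assume x: "x \<in> D" and y: "y \<in> D" and uv: "0 \<le> u" "0 \<le> v" "u + v = 1"
    have "sqrt (A x \<bullet> x) * sqrt (A y \<bullet> y) \<le> 1 * 1"
      using x y nonneg by (intro mult_mono) (auto simp: D_def)
    then have cross: "A x \<bullet> y \<le> 1"
      using CS[of x y] by linarith
    have "A y \<bullet> x = A x \<bullet> y"
      by (metis sym inner_commute)
    then have "A (u *\<^sub>R x + v *\<^sub>R y) \<bullet> (u *\<^sub>R x + v *\<^sub>R y)
        = u\<^sup>2 * (A x \<bullet> x) + 2 * u * v * (A x \<bullet> y) + v\<^sup>2 * (A y \<bullet> y)"
      using lin by (simp add: linear_add linear_cmul inner_simps power2_eq_square algebra_simps)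
    also have "\<dots> \<le> u\<^sup>2 * 1 + 2 * u * v * 1 + v\<^sup>2 * 1"
      using x y uv cross by (intro add_mono mult_left_mono) (auto simp: D_def)
    also have "\<dots> = (u + v)\<^sup>2"
      by (simp add: power2_sum)
    finally show "u *\<^sub>R x + v *\<^sub>R y \<in> D"
      using uv by (simp add: D_def)
  qed
  moreover have "closed D"
    unfolding D_def by (intro closed_Collect_le continuous_intros cont)
  moreover have "0 \<in> interior D"
  proof (rule interiorI)
    show "open {x. A x \<bullet> x < 1}"
      by (intro open_Collect_less continuous_intros cont)
  qed (auto simp: D_def)
  moreover have "minkowski_functional D x = ereal (sqrt (A x \<bullet> x))" for x
  proof -
    have "x \<in> (\<lambda>c. \<mu> *\<^sub>R c) ` D \<longleftrightarrow> sqrt (A x \<bullet> x) \<le> \<mu>" if "\<mu> \<ge> 0" for \<mu>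
    proof (cases "\<mu> = 0")
      case True
      \<comment> \<open>\<open>0 D = {0}\<close>, since \<open>D\<close> is nonempty.\<close>
      have "0 \<in> D"
        by (simp add: D_def)
      then have "x \<in> (\<lambda>c. \<mu> *\<^sub>R c) ` D \<longleftrightarrow> x = 0"
        using True by auto
      also have "\<dots> \<longleftrightarrow> sqrt (A x \<bullet> x) \<le> \<mu>"
        using True pos[of x] by force
      finally show ?thesis .
    next
      case False
      with that have \<mu>: "\<mu> > 0"
        by simp
      have "x \<in> (\<lambda>c. \<mu> *\<^sub>R c) ` D \<longleftrightarrow> (1 / \<mu>) *\<^sub>R x \<in> D"
        using \<mu> by (auto simp: image_iff intro: bexI[of _ "(1 / \<mu>) *\<^sub>R x"])
      also have "\<dots> \<longleftrightarrow> A x \<bullet> x \<le> \<mu>\<^sup>2"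
        using \<mu> unfolding D_def mem_Collect_eq q_scale by (simp add: field_simps)
      also have "\<dots> \<longleftrightarrow> sqrt (A x \<bullet> x) \<le> \<mu>"
        using \<mu> by (metis abs_of_pos real_sqrt_abs real_sqrt_le_iff)
      finally show ?thesis .
    qed
    then have "\<mu> \<ge> 0 \<and> x \<in> (\<lambda>c. \<mu> *\<^sub>R c) ` D \<longleftrightarrow> sqrt (A x \<bullet> x) \<le> \<mu>" for \<mu>
      using order_trans[OF real_sqrt_ge_zero[OF nonneg[of x]]] by blast
    then show ?thesis
      unfolding minkowski_functional_def by (auto intro!: Inf_eqI)
  qed
  moreover have "polar D = {x. inv A x \<bullet> x \<le> 1}"
  proof (intro set_eqI iffI)
    fix y
    assume "y \<in> {x. inv A x \<bullet> x \<le> 1}"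
    then have "x \<bullet> y \<le> 1" if "x \<in> D" for x
      using dual[OF that, of y] real_sqrt_le_1_iff[of "inv A y \<bullet> y"] by (auto simp del: real_sqrt_le_1_iff)
    then show "y \<in> polar D"
      by (simp add: polar_def inner_commute)
  next
    fix y
    assume y: "y \<in> polar D"
    let ?s = "inv A y \<bullet> y"
    show "y \<in> {x. inv A x \<bullet> x \<le> 1}"
    proof (rule ccontr)
      assume "y \<notin> {x. inv A x \<bullet> x \<le> 1}"
      then have s: "?s > 1"
        by simp
      \<comment> \<open>The multiple of \<open>A\<^sup>-\<^sup>1 y\<close> on the boundary of \<open>D\<close>, where \<open>x \<mapsto> x \<bullet> y\<close> is largest.\<close>
      let ?x = "(1 / sqrt ?s) *\<^sub>R inv A y"
      have "A ?x \<bullet> ?x = 1"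
        unfolding q_scale using s by (simp add: A_inv inner_commute power_divide)
      then have "?x \<in> D"
        by (simp add: D_def)
      then have "y \<bullet> ?x \<le> 1"
        using y by (auto simp: polar_def)
      moreover have "y \<bullet> ?x = sqrt ?s"
        using s by (simp add: inner_commute real_div_sqrt)
      moreover have "sqrt ?s > 1"
        using s by simp
      ultimately show False
        by linarith
    qed
  qed
  ultimately show ?thesis
    by blast
qed

end
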